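(* Let $\mathcal V=\{1,\dots,n\}$ and let $f:2^{\mathcal V}\to\mathbb R_{+}$ be a monotone submodular function with $f(\emptyset)=0$ and curvature $c$. Let $F:[0,1]^n\to\mathbb R_{+}$ be its multi-linear extension, and for $\mathbf x\in[0,1]^n$ put $$\nabla F^{s}(\mathbf x):=\int_0^1 e^{c(z-1)}\,\nabla F(z\mathbf x)\,dz .$$ Then for all $\mathbf x,\mathbf y\in[0,1]^n$, $$\langle\mathbf y-\mathbf x,\nabla F^{s}(\mathbf x)\rangle\ \ge\ \Big(\frac{1-e^{-c}}{c}\Big)F(\mathbf y)-F(\mathbf x).$$
   Context: $f$ is submodular if $f(S\cup\{e\})-f(S)\ge f(T\cup\{e\})-f(T)$ for all $S\subseteq T\subseteq\mathcal V$ and $e\in\mathcal V\setminus T$; monotone if $f(S)\le f(T)$ for $S\subseteq T$. The curvature of $f$ is $c:=1-\min_{S\subseteq\mathcal V,\,e\notin S}\frac{f(S\cup\{e\})-f(S)}{f(\{e\})}\in[0,1]$ (the minimum is over pairs with $f(\{e\})>0$; if there are none, $c:=0$). For $c=0$ the ratio $\frac{1-e^{-c}}{c}$ is read as its limit $1$. The multi-linear extension is $F(\mathbf x)=\sum_{\mathcal A\subseteq\mathcal V}f(\mathcal A)\prod_{a\in\mathcal A}x_a\prod_{a\notin\mathcal A}(1-x_a)$ for $\mathbf x\in[0,1]^n$; its gradient is that of this polynomial. $\langle\cdot,\cdot\rangle$ is the standard inner product, and the integral is taken coordinatewise. *)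

theory Defs
  imports "HOL-Analysis.Analysis"
begin

text \<open>The ground set is the universe of a finite type \<open>'n\<close>; points are vectors in \<open>real ^ 'n\<close>.\<close>

definition submodular :: "('n::finite set \<Rightarrow> real) \<Rightarrow> bool" where
  "submodular f \<longleftrightarrow>
     (\<forall>S T e. S \<subseteq> T \<and> e \<notin> T \<longrightarrow> f (S \<union> {e}) - f S \<ge> f (T \<union> {e}) - f T)"

definition marginal_ratios :: "('n::finite set \<Rightarrow> real) \<Rightarrow> real set" where
  "marginal_ratios f = {(f (S \<union> {e}) - f S) / f {e} | S e. e \<notin> S \<and> f {e} > 0}"

definition curvature :: "('n::finite set \<Rightarrow> real) \<Rightarrow> real" where
  "curvature f = (if marginal_ratios f = {} then 0 else 1 - Min (marginal_ratios f))"

definition curvature_factor :: "real \<Rightarrow> real" where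
  "curvature_factor c = (if c = 0 then 1 else (1 - exp (- c)) / c)"

text \<open>The polynomial is defined on all of \<open>real ^ 'n\<close>, so that its gradient makes sense on the
  boundary of the unit cube as well.\<close>

definition multilinear_extension :: "('n::finite set \<Rightarrow> real) \<Rightarrow> real ^ 'n \<Rightarrow> real" where
  "multilinear_extension f x =
     (\<Sum>A\<in>Pow UNIV. f A * (\<Prod>a\<in>A. x $ a) * (\<Prod>a\<in>- A. 1 - x $ a))"

definition unit_cube :: "(real ^ 'n::finite) set" where
  "unit_cube = {x. \<forall>i. 0 \<le> x $ i \<and> x $ i \<le> 1}"

definition gradient :: "('a::real_inner \<Rightarrow> real) \<Rightarrow> 'a \<Rightarrow> 'a" where
  "gradient F x = (THE D. GDERIV F x :> D)"

lemma gradient_eqI: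
  assumes "GDERIV F x :> D"
  shows "gradient F x = D"
  unfolding gradient_def
proof (rule the_equality[where a = D])
  show "GDERIV F x :> D" by (fact assms)
  fix D' assume "GDERIV F x :> D'"
  then have "(\<lambda>h. h \<bullet> D') = (\<lambda>h. h \<bullet> D)"
    using assms unfolding gderiv_def by (rule has_derivative_unique)
  then show "D' = D"
    by (metis inner_commute vector_eq_ldot)
qed

text \<open>With \<open>c = curvature f\<close> and \<open>F = multilinear_extension f\<close>, this is the vector
  \<open>\<nabla>F\<^sup>s(x)\<close>.\<close>

definition boosted_gradient :: "real \<Rightarrow> (real ^ 'n::finite \<Rightarrow> real) \<Rightarrow> real ^ 'n \<Rightarrow> real ^ 'n" where
  "boosted_gradient c F x =
     (\<chi> i. integral {0..1} (\<lambda>z. exp (c * (z - 1)) * gradient F (z *\<^sub>R x) $ i))"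

end

theory Submission
  imports Defs
begin

text \<open>Drawing a random set \<open>B\<close> that contains each \<open>i\<close> independently with probability \<open>y\<^sub>i\<close> gives
  \<open>F(y) = E f(B)\<close>, and \<open>\<partial>\<^sub>i F(p)\<close> is the expectation of \<open>f(R \<union> {i}) - f(R - {i})\<close> for \<open>R\<close> drawn
  from \<open>p\<close>. Submodularity and curvature give, for all sets,
  \<open>(\<Sum>i\<in>B. f(R \<union> {i}) - f(R - {i})) \<ge> f(B) - c f(R)\<close>; averaging over independent \<open>R\<close> and \<open>B\<close>
  yields \<open>\<langle>y, \<nabla>F(p)\<rangle> \<ge> F(y) - c F(p)\<close>. At \<open>p = zx\<close> the term \<open>c F(zx)\<close> is absorbed by the derivative
  of \<open>e\<^bsup>c(z-1)\<^esup> F(zx)\<close>, and integrating over \<open>z \<in> [0,1]\<close> gives the claim.\<close>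

section \<open>Curvature and submodularity\<close>

lemma finite_marginal_ratios: "finite (marginal_ratios f)"
  by (rule finite_subset[of _ "(\<lambda>(S, e). (f (S \<union> {e}) - f S) / f {e}) ` UNIV"])
     (auto simp: marginal_ratios_def)

text \<open>Clearing the denominator in the minimum gives the bound. Elements with
  \<open>f {e} = 0\<close> do not enter the minimum; for them the left side is zero and monotonicity
  suffices.\<close>

lemma curvature_marginal:
  assumes "mono f" "e \<notin> S" "\<And>S. f S \<ge> 0"
  shows "(1 - curvature f) * f {e} \<le> f (insert e S) - f S"
proof (cases "f {e} > 0")
  case True
  have mem: "(f (insert e S) - f S) / f {e} \<in> marginal_ratios f"
    unfolding marginal_ratios_def using True assms(2) by auto
  then have "1 - curvature f = Min (marginal_ratios f)"
    by (auto simp: curvature_def)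
  also have "\<dots> \<le> (f (insert e S) - f S) / f {e}"
    using finite_marginal_ratios mem by (rule Min_le)
  finally show ?thesis
    using True by (simp add: field_simps)
next
  case False
  then have "f {e} = 0" using assms(3)[of "{e}"] by simp
  moreover have "f S \<le> f (insert e S)" using assms(1) by (auto intro: monoD)
  ultimately show ?thesis by simp
qed

lemma curvature_le_1:
  assumes "mono f"
  shows "curvature f \<le> 1"
proof (cases "marginal_ratios f = {}")
  case False
  have "Min (marginal_ratios f) \<in> marginal_ratios f"
    using finite_marginal_ratios False by (rule Min_in)
  then have "Min (marginal_ratios f) \<ge> 0"
    unfolding marginal_ratios_def by (auto intro!: divide_nonneg_pos monoD[OF assms])
  with False show ?thesis by (simp add: curvature_def)
qed (simp add: curvature_def)

lemma submodular_marginal_antimono: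
  assumes "submodular f" "S \<subseteq> T" "e \<notin> T"
  shows "f (insert e T) - f T \<le> f (insert e S) - f S"
proof -
  have "f (S \<union> {e}) - f S \<ge> f (T \<union> {e}) - f T"
    using assms unfolding submodular_def by blast
  then show ?thesis by simp
qed

text \<open>Add the elements of \<open>B\<close> one at a time: each increment is taken over a
  superset of \<open>S\<close>, hence is at most the marginal over \<open>S\<close> itself.\<close>

lemma submodular_union_le:
  assumes "submodular f"
  shows "f (S \<union> B) - f S \<le> (\<Sum>b\<in>B. f (insert b S) - f S)"
proof -
  have "finite B" by simp
  then show ?thesis
  proof induction
    case (insert b B)
    have "f (insert b (S \<union> B)) - f (S \<union> B) \<le> f (insert b S) - f S"
    proof (cases "b \<in> S")
      case True
      then have "insert b (S \<union> B) = S \<union> B" "insert b S = S" by auto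
      then show ?thesis by simp
    next
      case False
      then show ?thesis
        using submodular_marginal_antimono[OF assms, of S "S \<union> B" b] insert.hyps by auto
    qed
    with insert show ?case by simp
  qed simp
qed

text \<open>The increments telescope as \<open>B\<close> is added to \<open>S\<close>. Disjointness
  makes every element of \<open>B\<close> new when it is added, so \<open>curvature_marginal\<close>
  bounds each one.\<close>

lemma curvature_union_ge:
  assumes "mono f" "\<And>S. f S \<ge> 0" "S \<inter> B = {}"
  shows "(1 - curvature f) * (\<Sum>b\<in>B. f {b}) \<le> f (S \<union> B) - f S"
proof -
  have "finite B" by simp
  then show ?thesis using assms(3)
  proof induction
    case (insert b B)
    have "(1 - curvature f) * f {b} \<le> f (insert b (S \<union> B)) - f (S \<union> B)"
      by (rule curvature_marginal[OF assms(1) _ assms(2)]) (use insert in auto)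
    with insert show ?case by (simp add: distrib_left)
  qed simp
qed

text \<open>Split \<open>B\<close> along \<open>R\<close>. Outside \<open>R\<close> the marginals
  sum to at least \<open>f (R \<union> B) - f R\<close>; inside, each is at least
  \<open>(1 - curvature f) * f {i}\<close>. Growing \<open>B\<close> to \<open>R \<union> B\<close>
  gains the same multiple of the singleton values on \<open>R - B\<close>, and together these cover
  \<open>(1 - curvature f) * f R\<close>.\<close>

lemma sum_marginals_ge:
  assumes "mono f" "submodular f" "f {} = 0" "\<And>S. f S \<ge> 0"
  shows "f B - curvature f * f R \<le> (\<Sum>i\<in>B. f (insert i R) - f (R - {i}))"
proof -
  let ?k = "1 - curvature f"
  have "f (R \<union> B) - f R \<le> (\<Sum>i\<in>B. f (insert i R) - f R)"
    by (rule submodular_union_le[OF assms(2)])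
  also have "\<dots> = (\<Sum>i\<in>B - R. f (insert i R) - f R)"
    by (rule sum.mono_neutral_right) (auto simp: insert_absorb)
  also have "\<dots> = (\<Sum>i\<in>B - R. f (insert i R) - f (R - {i}))"
    by (rule sum.cong) auto
  finally have outside: "f (R \<union> B) - f R \<le> (\<Sum>i\<in>B - R. f (insert i R) - f (R - {i}))" .
  have inside: "?k * (\<Sum>i\<in>B \<inter> R. f {i}) \<le> (\<Sum>i\<in>B \<inter> R. f (insert i R) - f (R - {i}))"
    unfolding sum_distrib_left
  proof (rule sum_mono)
    fix i assume "i \<in> B \<inter> R"
    then show "?k * f {i} \<le> f (insert i R) - f (R - {i})"
      using curvature_marginal[OF assms(1) _ assms(4), of i "R - {i}"] by simp
  qed
  have union: "?k * (\<Sum>i\<in>R - B. f {i}) \<le> f (R \<union> B) - f B"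
    using curvature_union_ge[OF assms(1) assms(4), of B "R - B"] by (simp add: Un_commute)
  \<comment> \<open>Subadditivity. Scaling it by \<open>1 - curvature f\<close> preserves its
    direction because the curvature is at most 1.\<close>
  have "f R \<le> (\<Sum>i\<in>R. f {i})"
    using submodular_union_le[OF assms(2), of "{}" R] assms(3) by simp
  also have "\<dots> = (\<Sum>i\<in>R - B. f {i}) + (\<Sum>i\<in>B \<inter> R. f {i})"
    by (subst sum.Int_Diff[of R _ B]) (auto simp: Int_commute)
  finally have "?k * f R \<le> ?k * (\<Sum>i\<in>R - B. f {i}) + ?k * (\<Sum>i\<in>B \<inter> R. f {i})"
    using curvature_le_1[OF assms(1)] by (simp flip: distrib_left add: mult_left_mono)
  moreover have "(\<Sum>i\<in>B. f (insert i R) - f (R - {i})) =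
      (\<Sum>i\<in>B \<inter> R. f (insert i R) - f (R - {i})) + (\<Sum>i\<in>B - R. f (insert i R) - f (R - {i}))"
    by (rule sum.Int_Diff) simp
  ultimately show ?thesis
    using outside inside union by (simp add: algebra_simps)
qed

section \<open>The product distribution of a random set\<close>

text \<open>The case split sits inside the factors, so the index set does not depend on
  \<open>A\<close>; one factor can be split off, and the product rule applies directly.\<close>

definition set_prob :: "real ^ 'n::finite \<Rightarrow> 'n set \<Rightarrow> real" where
  "set_prob x A = (\<Prod>a\<in>UNIV. if a \<in> A then x $ a else 1 - x $ a)"

lemma set_prob_altdef: "set_prob x A = (\<Prod>a\<in>A. x $ a) * (\<Prod>a\<in>- A. 1 - x $ a)"
  unfolding set_prob_def by (subst prod.If_cases) (auto simp: Compl_eq)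

lemma multilinear_extension_altdef: "multilinear_extension f x = (\<Sum>A\<in>UNIV. f A * set_prob x A)"
  unfolding multilinear_extension_def set_prob_altdef by (simp add: mult.assoc)

lemma set_prob_nonneg: "x \<in> unit_cube \<Longrightarrow> set_prob x A \<ge> 0"
  unfolding set_prob_def unit_cube_def by (auto intro!: prod_nonneg)

lemma sum_UNIV_split_insert:
  fixes g :: "'n::finite set \<Rightarrow> real"
  shows "(\<Sum>A\<in>UNIV. g A) = (\<Sum>A | i \<notin> A. g A + g (insert i A))"
proof -
  have "(\<Sum>A\<in>UNIV. g A) = (\<Sum>A | i \<notin> A. g A) + (\<Sum>A | i \<in> A. g A)"
    by (subst sum.union_disjoint[symmetric]) (auto intro: sum.cong)
  also have "(\<Sum>A | i \<in> A. g A) = (\<Sum>A | i \<notin> A. g (insert i A))"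
    by (rule sum.reindex_bij_witness[of _ "insert i" "\<lambda>A. A - {i}"]) (auto simp: insert_absorb)
  finally show ?thesis by (simp add: sum.distrib)
qed

text \<open>Expand the product of the factors \<open>x $ a + (1 - x $ a) = 1\<close> over all
  subsets.\<close>

lemma sum_set_prob: "(\<Sum>A\<in>UNIV. set_prob x A) = 1"
  using prod_add[of UNIV "\<lambda>a. x $ a" "\<lambda>a. 1 - x $ a"]
  by (simp add: set_prob_altdef Compl_eq_Diff_UNIV)

lemma set_prob_split:
  "set_prob x A = (if i \<in> A then x $ i else 1 - x $ i) * (\<Prod>a\<in>- {i}. if a \<in> A then x $ a else 1 - x $ a)"
  unfolding set_prob_def Compl_eq_Diff_UNIV by (rule prod.remove) auto

lemma sum_set_prob_marginal: "(\<Sum>A\<in>UNIV. of_bool (i \<in> A) * set_prob x A) = x $ i"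
proof -
  define W where "W A = (\<Prod>a\<in>- {i}. if a \<in> A then x $ a else 1 - x $ a)" for A
  have W_insert: "W (insert i A) = W A" for A
    unfolding W_def by (rule prod.cong) auto
  \<comment> \<open>In each pair \<open>A\<close>, \<open>insert i A\<close> the factors of
    coordinate \<open>i\<close> add up to 1, leaving the weight \<open>W A\<close> of the other
    coordinates.\<close>
  have "(\<Sum>A | i \<notin> A. W A) = 1"
    using sum_set_prob[of x] unfolding sum_UNIV_split_insert[of _ i] set_prob_split[of _ _ i]
    by (simp add: W_def[symmetric] W_insert flip: distrib_right)
  then show ?thesis
    unfolding sum_UNIV_split_insert[of _ i] set_prob_split[of _ _ i]
    by (simp add: W_def[symmetric] W_insert flip: sum_distrib_left)
qed

section \<open>The gradient of the multilinear extension\<close>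

definition multilinear_gradient :: "('n::finite set \<Rightarrow> real) \<Rightarrow> real ^ 'n \<Rightarrow> real ^ 'n" where
  "multilinear_gradient f x =
     (\<chi> i. multilinear_extension (\<lambda>A. f (insert i A) - f (A - {i})) x)"

text \<open>This is the form that the product rule yields: the factor of \<open>i\<close> is
  replaced by its derivative, 1 or -1.\<close>

lemma multilinear_gradient_component:
  "multilinear_gradient f x $ i =
     (\<Sum>A\<in>UNIV. f A * (if i \<in> A then 1 else - 1) *
       (\<Prod>a\<in>- {i}. if a \<in> A then x $ a else 1 - x $ a))"
proof -
  define W where "W A = (\<Prod>a\<in>- {i}. if a \<in> A then x $ a else 1 - x $ a)" for A
  have W_insert: "W (insert i A) = W A" for A
    unfolding W_def by (rule prod.cong) auto
  show ?thesis
    unfolding multilinear_gradient_def multilinear_extension_altdef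
      sum_UNIV_split_insert[of _ i] set_prob_split[of _ _ i]
    by (simp add: W_def[symmetric] W_insert) (auto intro!: sum.cong simp: algebra_simps)
qed

lemma has_derivative_multilinear_extension:
  "(multilinear_extension f has_derivative (\<lambda>h. h \<bullet> multilinear_gradient f x)) (at x)"
proof -
  have coord: "((\<lambda>x. if a \<in> A then x $ a else 1 - x $ a) has_derivative
      (\<lambda>h. if a \<in> A then h $ a else - h $ a)) (at x)" for a and A :: "'a set"
    by (cases "a \<in> A") (auto intro!: derivative_eq_intros
        bounded_linear_imp_has_derivative bounded_linear_vec_nth)
  have "((\<lambda>x. \<Sum>A\<in>UNIV. f A * (\<Prod>a\<in>UNIV. if a \<in> A then x $ a else 1 - x $ a)) has_derivative
    (\<lambda>h. \<Sum>A\<in>UNIV. f A * (\<Sum>i\<in>UNIV. (if i \<in> A then h $ i else - h $ i) *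
       (\<Prod>a\<in>UNIV - {i}. if a \<in> A then x $ a else 1 - x $ a)))) (at x)"
    by (intro has_derivative_sum has_derivative_mult_right has_derivative_prod coord)
  also have "(\<lambda>h. \<Sum>A\<in>UNIV. f A * (\<Sum>i\<in>UNIV. (if i \<in> A then h $ i else - h $ i) *
       (\<Prod>a\<in>UNIV - {i}. if a \<in> A then x $ a else 1 - x $ a))) =
    (\<lambda>h. h \<bullet> multilinear_gradient f x)"
    unfolding inner_vec_def multilinear_gradient_component sum_distrib_left inner_real_def
    by (subst sum.swap) (auto intro!: ext sum.cong simp: Compl_eq_Diff_UNIV)
  finally show ?thesis
    by (simp add: multilinear_extension_altdef[abs_def] set_prob_def)
qed

lemma gradient_multilinear_extension:
  "gradient (multilinear_extension f) x = multilinear_gradient f x"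
  by (rule gradient_eqI) (simp add: gderiv_def has_derivative_multilinear_extension)

lemma continuous_on_multilinear_gradient:
  "continuous_on S g \<Longrightarrow> continuous_on S (\<lambda>z. multilinear_gradient f (g z) $ i)"
  unfolding multilinear_gradient_def multilinear_extension_def
  by (auto intro!: continuous_intros)

lemma inner_multilinear_gradient_ge:
  assumes "mono f" "submodular f" "f {} = 0" "\<And>S. f S \<ge> 0" "p \<in> unit_cube" "y \<in> unit_cube"
  shows "multilinear_extension f y - curvature f * multilinear_extension f p
    \<le> y \<bullet> multilinear_gradient f p"
proof -
  \<comment> \<open>Each term is multiplied by a total mass of 1, which turns both into double sums
    over \<open>B\<close> and \<open>R\<close>.\<close>
  have "multilinear_extension f y - curvature f * multilinear_extension f p =
    (\<Sum>B\<in>UNIV. f B * set_prob y B) * (\<Sum>R\<in>UNIV. set_prob p R)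
    - curvature f * ((\<Sum>B\<in>UNIV. set_prob y B) * (\<Sum>R\<in>UNIV. f R * set_prob p R))"
    by (simp add: multilinear_extension_altdef sum_set_prob)
  also have "\<dots> = (\<Sum>B\<in>UNIV. \<Sum>R\<in>UNIV. set_prob y B * set_prob p R * (f B - curvature f * f R))"
    unfolding sum_product
    unfolding sum_distrib_left sum_subtractf[symmetric]
    by (intro sum.cong) (auto simp: algebra_simps)
  also have "\<dots> \<le> (\<Sum>B\<in>UNIV. \<Sum>R\<in>UNIV. set_prob y B * set_prob p R *
      (\<Sum>i\<in>B. f (insert i R) - f (R - {i})))"
    using assms by (intro sum_mono mult_left_mono sum_marginals_ge) (auto simp: set_prob_nonneg)
  also have "\<dots> = (\<Sum>B\<in>UNIV. \<Sum>R\<in>UNIV. \<Sum>i\<in>UNIV.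
      (of_bool (i \<in> B) * set_prob y B) * ((f (insert i R) - f (R - {i})) * set_prob p R))"
  proof (intro sum.cong refl)
    fix B R
    have *: "(\<Sum>i\<in>B. f (insert i R) - f (R - {i})) =
        (\<Sum>i\<in>UNIV. of_bool (i \<in> B) * (f (insert i R) - f (R - {i})))"
      by (rule sum.mono_neutral_cong_left) auto
    show "set_prob y B * set_prob p R * (\<Sum>i\<in>B. f (insert i R) - f (R - {i})) = (\<Sum>i\<in>UNIV.
      (of_bool (i \<in> B) * set_prob y B) * ((f (insert i R) - f (R - {i})) * set_prob p R))"
      unfolding * sum_distrib_left by (simp only: mult_ac)
  qed
  also have "\<dots> = (\<Sum>B\<in>UNIV. \<Sum>i\<in>UNIV. \<Sum>R\<in>UNIV.
      (of_bool (i \<in> B) * set_prob y B) * ((f (insert i R) - f (R - {i})) * set_prob p R))"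
    by (intro sum.cong refl sum.swap)
  also have "\<dots> = (\<Sum>i\<in>UNIV. \<Sum>B\<in>UNIV. \<Sum>R\<in>UNIV.
      (of_bool (i \<in> B) * set_prob y B) * ((f (insert i R) - f (R - {i})) * set_prob p R))"
    by (rule sum.swap)
  \<comment> \<open>For fixed \<open>i\<close> the double sum factors: the sum over \<open>B\<close>
    is \<open>y $ i\<close>, the sum over \<open>R\<close> is the gradient component.\<close>
  also have "\<dots> = y \<bullet> multilinear_gradient f p"
    unfolding inner_vec_def multilinear_gradient_def
    by (simp flip: sum_product add: sum_set_prob_marginal multilinear_extension_altdef)
  finally show ?thesis .
qed

section \<open>Integration along the ray\<close>

lemma multilinear_extension_0: "multilinear_extension f 0 = f {}"
proof -
  have "set_prob (0 :: real ^ 'a) A = (if A = {} then 1 else 0)" for A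
    by (auto simp: set_prob_altdef)
  then have "multilinear_extension f 0 = (\<Sum>A\<in>UNIV. if A = {} then f A else 0)"
    unfolding multilinear_extension_altdef by (intro sum.cong) auto
  then show ?thesis by simp
qed

lemma has_integral_exp_curvature_factor:
  "((\<lambda>z. exp (c * (z - 1))) has_integral curvature_factor c) {0..1::real}"
proof (cases "c = 0")
  case True
  then show ?thesis
    using has_integral_const_real[of "1::real" 0 1] by (simp add: curvature_factor_def)
next
  case False
  have "((\<lambda>z. exp (c * (z - 1))) has_integral
      (exp (c * (1 - 1)) / c - exp (c * (0 - 1)) / c)) {0..1::real}"
    by (rule fundamental_theorem_of_calculus)
       (use False in \<open>auto intro!: derivative_eq_intros
          simp flip: has_real_derivative_iff_has_vector_derivative\<close>)
  with False show ?thesis by (simp add: curvature_factor_def diff_divide_distrib)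
qed

theorem theorem2:
  fixes f :: "'n::finite set \<Rightarrow> real" and c :: real and F :: "real ^ 'n \<Rightarrow> real"
    and x y :: "real ^ 'n"
  assumes "\<And>S. f S \<ge> 0"
    and "mono f"
    and "submodular f"
    and "f {} = 0"
    and "c = curvature f"
    and "F = multilinear_extension f"
    and "x \<in> unit_cube" and "y \<in> unit_cube"
  shows "(y - x) \<bullet> boosted_gradient c F x \<ge> curvature_factor c * F y - F x"
proof -
  define w where "w z = exp (c * (z - 1))" for z :: real
  define G where "G z = multilinear_gradient f (z *\<^sub>R x)" for z
  have "(\<lambda>z. w z * G z $ i) integrable_on {0..1}" for i
    unfolding w_def G_def
    by (intro integrable_continuous_real continuous_on_multilinear_gradient continuous_intros)
  then have "((\<lambda>z. \<Sum>i\<in>UNIV. (y - x) $ i * (w z * G z $ i)) has_integral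
      (\<Sum>i\<in>UNIV. (y - x) $ i * integral {0..1} (\<lambda>z. w z * G z $ i))) {0..1}"
    by (intro has_integral_sum has_integral_mult_right integrable_integral) auto
  also have "(\<Sum>i\<in>UNIV. (y - x) $ i * integral {0..1} (\<lambda>z. w z * G z $ i)) =
      (y - x) \<bullet> boosted_gradient c F x"
    by (simp add: inner_vec_def boosted_gradient_def assms(6) gradient_multilinear_extension
        w_def G_def)
  also have "(\<lambda>z. \<Sum>i\<in>UNIV. (y - x) $ i * (w z * G z $ i)) = (\<lambda>z. w z * ((y - x) \<bullet> G z))"
    by (simp add: inner_vec_def sum_distrib_left mult_ac)
  finally have lhs: "((\<lambda>z. w z * ((y - x) \<bullet> G z)) has_integral
      (y - x) \<bullet> boosted_gradient c F x) {0..1}" .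
  have deriv_F: "((\<lambda>z. F (z *\<^sub>R x)) has_real_derivative x \<bullet> G z) (at z)" for z
  proof -
    have "((\<lambda>z. z *\<^sub>R x) has_derivative (\<lambda>h. h *\<^sub>R x)) (at z)"
      by (auto intro!: derivative_eq_intros)
    from has_derivative_compose[OF this has_derivative_multilinear_extension]
    have "((\<lambda>z. F (z *\<^sub>R x)) has_derivative (\<lambda>h. (h *\<^sub>R x) \<bullet> G z)) (at z)"
      by (simp only: assms(6) G_def)
    then show ?thesis
      unfolding has_field_derivative_def by (rule has_derivative_eq_rhs) (auto simp: mult.commute)
  qed
  \<comment> \<open>The integrand is the derivative of \<open>w z * F (z *\<^sub>R x)\<close>, as
    \<open>w\<close> has derivative \<open>c * w z\<close>. The boundary terms reduce to
    \<open>F x\<close>, since \<open>w 1 = 1\<close> and \<open>F\<close> vanishes at the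
    origin.\<close>
  have "((\<lambda>z. c * w z * F (z *\<^sub>R x) + w z * (x \<bullet> G z)) has_integral
      (w 1 * F (1 *\<^sub>R x) - w 0 * F (0 *\<^sub>R x))) {0..1}"
  proof (rule fundamental_theorem_of_calculus)
    fix z :: real
    have "((\<lambda>z. w z * F (z *\<^sub>R x)) has_real_derivative
        c * w z * F (z *\<^sub>R x) + w z * (x \<bullet> G z)) (at z)"
      unfolding w_def by (auto intro!: derivative_eq_intros deriv_F)
    then show "((\<lambda>z. w z * F (z *\<^sub>R x)) has_vector_derivative
        c * w z * F (z *\<^sub>R x) + w z * (x \<bullet> G z)) (at z within {0..1})"
      by (auto simp flip: has_real_derivative_iff_has_vector_derivative
          intro: has_field_derivative_at_within)
  qed simp
  then have "((\<lambda>z. c * w z * F (z *\<^sub>R x) + w z * (x \<bullet> G z)) has_integral F x) {0..1}"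
    by (simp add: w_def assms(4,6) multilinear_extension_0)
  then have rhs: "((\<lambda>z. w z * F y - (c * w z * F (z *\<^sub>R x) + w z * (x \<bullet> G z))) has_integral
      (curvature_factor c * F y - F x)) {0..1}"
    using has_integral_exp_curvature_factor[of c]
    by (intro has_integral_diff has_integral_mult_left) (auto simp: w_def)
  show ?thesis
  proof (rule has_integral_le[OF rhs lhs])
    fix z :: real assume z: "z \<in> {0..1}"
    then have "z *\<^sub>R x \<in> unit_cube"
      using assms(7) by (auto simp: unit_cube_def mult_le_one)
    then have "F y - c * F (z *\<^sub>R x) \<le> y \<bullet> G z"
      unfolding assms(5,6) G_def by (intro inner_multilinear_gradient_ge assms)
    then have "w z * (F y - c * F (z *\<^sub>R x)) \<le> w z * (y \<bullet> G z)"
      by (simp add: w_def)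
    \<comment> \<open>The terms \<open>w z * (x \<bullet> G z)\<close> on both sides cancel.\<close>
    then show "w z * F y - (c * w z * F (z *\<^sub>R x) + w z * (x \<bullet> G z)) \<le> w z * ((y - x) \<bullet> G z)"
      by (simp add: algebra_simps inner_diff_left)
  qed
qed

end
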